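(* Let $0<q<1$ and let $\eta,\kappa,\sigma,c\in\mathbb{C}$ with $\Re(\eta)>0$, $\Re(\kappa)>0$ and $\Re(c)>\Re(\sigma)>0$. Then for every $u\in\mathbb{C}$ with $|u|<(1-q)^{-\Re(\eta)}$, $$E_{\eta,\kappa}^{(\sigma;c)}(u;q)=\frac{1}{B_q(\sigma,c-\sigma)}\int_0^1 t^{\sigma-1}\,\frac{(tq;q)_\infty}{(tq^{c-\sigma};q)_\infty}\,E_{\eta,\kappa}^{c}(tu;q)\,d_qt .$$
   Context: Let $0<q<1$. For $\lambda\in\mathbb{C}$, $(\lambda;q)_0=1$, $(\lambda;q)_m=\prod_{i=0}^{m-1}(1-\lambda q^i)$ for $m\ge1$, and $(\lambda;q)_\infty=\prod_{i\ge0}(1-\lambda q^i)$. For complex $z$, $q^z=e^{z\ln q}$. The $q$-gamma function is $\Gamma_q(z)=\frac{(q;q)_\infty}{(q^z;q)_\infty}(1-q)^{1-z}$; at its poles $1/\Gamma_q(z)$ is read as $0$. The $q$-beta function is $B_q(a,b)=\frac{\Gamma_q(a)\Gamma_q(b)}{\Gamma_q(a+b)}$ for $\Re(a),\Re(b)>0$. The $q$-integral is $\int_0^u f(t)\,d_qt=u(1-q)\sum_{k=0}^\infty q^k f(uq^k)$. The generalized $q$-Mittag-Leffler function is $$E_{\eta,\kappa}^{c}(u;q)=\sum_{m=0}^\infty\frac{(q^{c};q)_m}{(q;q)_m}\frac{u^m}{\Gamma_q(\eta m+\kappa)}.$$ The extended $q$-Mittag-Leffler function is, for $\Re(c)>\Re(\sigma)>0$,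 $$E_{\eta,\kappa}^{(\sigma;c)}(u;q)=\sum_{m=0}^\infty\frac{B_q(\sigma+m,c-\sigma)}{B_q(\sigma,c-\sigma)}\,\frac{(q^{c};q)_m}{(q;q)_m}\,\frac{u^m}{\Gamma_q(\eta m+\kappa)}.$$ *)

theory Defs
  imports "HOL-Analysis.Analysis"
begin

text \<open>
  Throughout, the base is a real number \<open>q\<close>, intended to satisfy \<open>0 < q < 1\<close>. Then the principal
  power \<open>complex_of_real q powr z\<close> is \<open>exp (z * ln q)\<close> with the real logarithm.
\<close>

definition q_poch :: "real \<Rightarrow> complex \<Rightarrow> nat \<Rightarrow> complex" where
  "q_poch q l m = (\<Prod>i<m. 1 - l * of_real q ^ i)"

definition q_poch_inf :: "real \<Rightarrow> complex \<Rightarrow> complex" where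
  "q_poch_inf q l = (\<Prod>i. 1 - l * of_real q ^ i)"

text \<open>
  At a pole, where \<open>q_poch_inf q (q powr z) = 0\<close>, division by zero gives \<open>q_Gamma q z = 0\<close>, so that
  \<open>1 / q_Gamma q z = 0\<close>, as the usual convention on the reciprocal requires.
\<close>

definition q_Gamma :: "real \<Rightarrow> complex \<Rightarrow> complex" where
  "q_Gamma q z =
     q_poch_inf q (of_real q) / q_poch_inf q (of_real q powr z) * of_real (1 - q) powr (1 - z)"

definition q_Beta :: "real \<Rightarrow> complex \<Rightarrow> complex \<Rightarrow> complex" where
  "q_Beta q a b = q_Gamma q a * q_Gamma q b / q_Gamma q (a + b)"

definition q_integral :: "real \<Rightarrow> real \<Rightarrow> (real \<Rightarrow> complex) \<Rightarrow> complex" where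
  "q_integral q u f = of_real (u * (1 - q)) * (\<Sum>k. of_real (q ^ k) * f (u * q ^ k))"

definition q_ML :: "real \<Rightarrow> complex \<Rightarrow> complex \<Rightarrow> complex \<Rightarrow> complex \<Rightarrow> complex" where
  "q_ML q \<eta> \<kappa> c u =
     (\<Sum>m. q_poch q (of_real q powr c) m / q_poch q (of_real q) m
            * (u ^ m / q_Gamma q (\<eta> * of_nat m + \<kappa>)))"

definition q_ML_ext ::
    "real \<Rightarrow> complex \<Rightarrow> complex \<Rightarrow> complex \<Rightarrow> complex \<Rightarrow> complex \<Rightarrow> complex" where
  "q_ML_ext q \<eta> \<kappa> \<sigma> c u =
     (\<Sum>m. q_Beta q (\<sigma> + of_nat m) (c - \<sigma>) / q_Beta q \<sigma> (c - \<sigma>)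
            * (q_poch q (of_real q powr c) m / q_poch q (of_real q) m)
            * (u ^ m / q_Gamma q (\<eta> * of_nat m + \<kappa>)))"

end

theory Submission
  imports Defs
begin

text \<open>
  Expand the \<open>q\<close>-Mittag-Leffler function under the \<open>q\<close>-integral into its power series and exchange
  the sum over the exponent \<open>m\<close> with the sum over the nodes \<open>q ^ k\<close> of the \<open>q\<close>-integral.  The factor
  \<open>t ^ m\<close> turns \<open>t powr (\<sigma> - 1)\<close> into \<open>t powr (\<sigma> + m - 1)\<close>, so the inner sum is the \<open>q\<close>-integral
  representation of \<open>q_Beta q (\<sigma> + m) (c - \<sigma>)\<close>, and what remains is the series that defines the
  extended function.

  The integral representation of the \<open>q\<close>-beta function (\<open>q_beta_sums\<close>) is the \<open>q\<close>-binomial theorem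
  in disguise: at \<open>t = q ^ k\<close> the quotient of infinite products in the kernel is a constant times
  the \<open>k\<close>-th coefficient of the \<open>q\<close>-binomial series (\<open>jackson_kernel_eq\<close>).  The \<open>q\<close>-binomial theorem
  (\<open>q_binomial\<close>) comes from the functional equation \<open>(1 - z) F(z) = (1 - a z) F(q z)\<close> of the series,
  iterated down to the value of \<open>F\<close> at \<open>0\<close>.

  The exchange of sums (\<open>suminf_swap_dominated\<close>) uses a bound of the double series by a product of
  two convergent ones.  In the index \<open>k\<close> this is the geometric series of ratio \<open>q powr Re \<sigma>\<close>, since
  the kernel is bounded.  In the index \<open>m\<close> it is the series of the \<open>q\<close>-Mittag-Leffler function itself:
  the quotients of \<open>q\<close>-shifted factorials in it are bounded, and \<open>1 / q_Gamma q (\<eta> * m + \<kappa>)\<close> is at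
  most a constant times \<open>(1 - q) powr (Re \<eta> * m)\<close>, whence the radius \<open>(1 - q) powr (- Re \<eta>)\<close>
  (\<open>summable_q_ML\<close>).
\<close>

section \<open>Exchanging two dominated series\<close>

lemma sums_infsum:
  fixes f :: "nat \<Rightarrow> complex"
  assumes "f summable_on UNIV"
  shows "f sums infsum f UNIV"
  using assms by (intro has_sum_imp_sums has_sum_infsum)

lemma suminf_swap_dominated:
  fixes f :: "nat \<Rightarrow> nat \<Rightarrow> complex"
  assumes bound: "\<And>m k. norm (f m k) \<le> A m * B k"
    and A: "summable A" "\<And>m. 0 \<le> A m" and B: "summable B" "\<And>k. 0 \<le> B k"
  shows "(\<lambda>m. \<Sum>k. f m k) sums (\<Sum>k. \<Sum>m. f m k)"
proof -
  have B': "(B has_sum suminf B) UNIV"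
    using B by (intro sums_nonneg_imp_has_sum summable_sums) auto
  have A': "A summable_on UNIV"
    using A by (simp add: summable_on_UNIV_nonneg_real_iff)
  have "(\<lambda>p. A (fst p) * B (snd p)) summable_on UNIV \<times> UNIV"
  proof (rule summable_on_SigmaI[where g = "\<lambda>m. A m * suminf B"])
    show "((\<lambda>y. A (fst (x, y)) * B (snd (x, y))) has_sum A x * suminf B) UNIV" for x
      using has_sum_cmult_right[OF B'] by simp
    show "(\<lambda>m. A m * suminf B) summable_on UNIV"
      using A' by (rule summable_on_cmult_left)
  qed (use A B in auto)
  then have "(\<lambda>p. norm (f (fst p) (snd p))) summable_on UNIV \<times> UNIV"
    by (rule Infinite_Sum.abs_summable_on_comparison_test') (use bound in auto)
  then have S: "(\<lambda>(m, k). f m k) summable_on UNIV \<times> UNIV"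
    by (simp add: abs_summable_summable case_prod_unfold)
  then have S': "(\<lambda>(k, m). f m k) summable_on UNIV \<times> UNIV"
    using summable_on_swap[of "\<lambda>(m, k). f m k" UNIV UNIV] by (simp add: case_prod_unfold)
  have norm_m: "(\<lambda>k. f m k) summable_on UNIV" for m
    by (intro norm_summable_imp_summable_on summable_comparison_test'[OF summable_mult[OF B(1)]])
       (use bound in auto)
  have norm_k: "(\<lambda>m. f m k) summable_on UNIV" for k
    by (intro norm_summable_imp_summable_on summable_comparison_test'[OF summable_mult2[OF A(1)]])
       (use bound in auto)
  have inner_m: "infsum (\<lambda>k. f m k) UNIV = (\<Sum>k. f m k)" for m
    using sums_unique[OF sums_infsum[OF norm_m]] .
  have inner_k: "infsum (\<lambda>m. f m k) UNIV = (\<Sum>m. f m k)" for k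
    using sums_unique[OF sums_infsum[OF norm_k]] .
  have "(\<lambda>m. \<Sum>k. f m k) sums infsum (\<lambda>m. \<Sum>k. f m k) UNIV"
    using sums_infsum[OF summable_on_Sigma_banach[OF S]] by (simp add: inner_m)
  also have "infsum (\<lambda>m. \<Sum>k. f m k) UNIV = infsum (\<lambda>k. \<Sum>m. f m k) UNIV"
    using infsum_swap_banach[OF S] by (simp add: inner_m inner_k)
  also have "\<dots> = (\<Sum>k. \<Sum>m. f m k)"
    using sums_unique[OF sums_infsum[OF summable_on_Sigma_banach[OF S']]]
    by (simp add: inner_k)
  finally show ?thesis .
qed

context
  fixes q :: real
  assumes q: "0 < q" "q < 1"
begin

section \<open>Finite and infinite \<open>q\<close>-shifted factorials\<close>

lemma q_poch_Suc: "q_poch q l (Suc n) = q_poch q l n * (1 - l * of_real q ^ n)"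
  by (simp add: q_poch_def)

lemma q_poch_add: "q_poch q l (k + n) = q_poch q l k * q_poch q (l * of_real q ^ k) n"
  by (induction n) (simp_all add: q_poch_def power_add mult_ac)

lemma norm_mult_q_power_less_1:
  assumes "norm (l :: complex) < 1"
  shows "norm (l * of_real q ^ i) < 1"
  using q assms by (simp add: norm_mult norm_power)
     (metis le_less_trans mult.right_neutral mult_left_mono norm_ge_zero power_le_one less_imp_le)

lemma one_minus_ne_0_of_norm_less_1:
  "norm (l :: complex) < 1 \<Longrightarrow> 1 - l * of_real q ^ i \<noteq> 0"
  using norm_mult_q_power_less_1[of l i] by auto

lemma q_poch_nonzero: "norm l < 1 \<Longrightarrow> q_poch q l n \<noteq> 0"
  using one_minus_ne_0_of_norm_less_1[of l] unfolding q_poch_def by (simp add: prod_zero_iff)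

lemma convergent_prod_q_poch: "convergent_prod (\<lambda>i. 1 - l * complex_of_real q ^ i)"
proof (rule abs_convergent_prod_imp_convergent_prod, rule summable_imp_abs_convergent_prod)
  show "summable (\<lambda>i. norm (1 - l * complex_of_real q ^ i - 1))"
    using q by (simp add: norm_mult norm_power summable_mult summable_geometric)
qed

lemma q_poch_LIMSEQ: "q_poch q l \<longlonglongrightarrow> q_poch_inf q l"
  using convergent_prod_LIMSEQ[OF convergent_prod_q_poch[of l]]
  unfolding q_poch_inf_def q_poch_def[abs_def]
  by (simp add: LIMSEQ_lessThan_iff_atMost)

lemma q_poch_inf_nonzero: "norm l < 1 \<Longrightarrow> q_poch_inf q l \<noteq> 0"
  unfolding q_poch_inf_def
  by (intro prodinf_nonzero convergent_prod_q_poch one_minus_ne_0_of_norm_less_1)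

lemma q_poch_inf_split: "q_poch_inf q l = q_poch q l k * q_poch_inf q (l * of_real q ^ k)"
proof (rule LIMSEQ_unique)
  show "(\<lambda>n. q_poch q l (n + k)) \<longlonglongrightarrow> q_poch_inf q l"
    using q_poch_LIMSEQ by (rule LIMSEQ_ignore_initial_segment)
  show "(\<lambda>n. q_poch q l (n + k)) \<longlonglongrightarrow> q_poch q l k * q_poch_inf q (l * of_real q ^ k)"
    unfolding add.commute[of _ k] q_poch_add by (intro tendsto_intros q_poch_LIMSEQ)
qed

text \<open>
  From \<open>1 + x \<le> exp x\<close>, applied to each factor.  The bound depends on \<open>norm l\<close> alone, so it
  controls \<open>1 / q_Gamma q z\<close> uniformly in \<open>z\<close>.
\<close>

lemma norm_q_poch_inf_le: "norm (q_poch_inf q l) \<le> exp (norm l / (1 - q))"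
proof (rule LIMSEQ_le_const2[OF tendsto_norm[OF q_poch_LIMSEQ]], intro exI allI impI)
  fix n :: nat
  have "norm (q_poch q l n) \<le> (\<Prod>i<n. exp (norm l * q ^ i))"
    unfolding q_poch_def prod_norm[symmetric]
  proof (intro prod_mono conjI norm_ge_zero)
    fix i
    have "norm (1 - l * of_real q ^ i) \<le> 1 + norm l * q ^ i"
      using norm_triangle_ineq4[of 1 "l * of_real q ^ i"] q by (simp add: norm_mult norm_power)
    also have "\<dots> \<le> exp (norm l * q ^ i)"
      by (rule exp_ge_add_one_self)
    finally show "norm (1 - l * of_real q ^ i) \<le> exp (norm l * q ^ i)" .
  qed
  also have "\<dots> = exp (norm l * (\<Sum>i<n. q ^ i))"
    by (simp add: exp_sum sum_distrib_left)
  also have "\<dots> \<le> exp (norm l * (1 / (1 - q)))"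
  proof -
    have "(\<Sum>i<n. q ^ i) \<le> (\<Sum>i. q ^ i)"
      using q by (intro sum_le_suminf summable_geometric) auto
    also have "\<dots> = 1 / (1 - q)"
      using q by (simp add: suminf_geometric)
    finally show ?thesis
      by (simp add: mult_left_mono del: times_divide_eq_right mult_1_right)
  qed
  finally show "norm (q_poch q l n) \<le> exp (norm l / (1 - q))" by simp
qed

text \<open>Numerator and denominator both converge, the latter to a nonzero limit.\<close>

lemma q_poch_ratio_bounded:
  obtains C where "C > 0" "\<And>n. norm (q_poch q l n / q_poch q (of_real q) n) \<le> C"
proof -
  have "(\<lambda>n. q_poch q l n / q_poch q (of_real q) n) \<longlonglongrightarrow> q_poch_inf q l / q_poch_inf q (of_real q)"
    using q by (intro tendsto_divide q_poch_LIMSEQ q_poch_inf_nonzero) auto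
  then have "Bseq (\<lambda>n. q_poch q l n / q_poch q (of_real q) n)"
    by (intro convergent_imp_Bseq convergentI)
  then show ?thesis using that by (auto simp: Bseq_def)
qed

section \<open>The \<open>q\<close>-binomial theorem\<close>

text \<open>
  The coefficients \<open>c n = (a;q)\<^sub>n / (q;q)\<^sub>n\<close> satisfy \<open>c (n+1) (1 - q ^ (n+1)) = c n (1 - a q ^ n)\<close>.
  Summed against \<open>z ^ (n+1)\<close>, this says \<open>F(z) - F(q z) = z (F(z) - a F(q z))\<close>.  Iterating the
  resulting equation relates \<open>F(z)\<close> to \<open>F(z q ^ n)\<close>, which tends to \<open>F(0) = 1\<close>.
\<close>

lemma q_binomial:
  assumes z: "norm z < 1"
  shows "(\<lambda>n. q_poch q a n / q_poch q (of_real q) n * z ^ n) sums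
           (q_poch_inf q (a * z) / q_poch_inf q z)"
proof -
  define c where "c n = q_poch q a n / q_poch q (of_real q) n" for n
  define F where "F z = (\<Sum>n. c n * z ^ n)" for z
  obtain C where C: "C > 0" "\<And>n. norm (c n) \<le> C"
    using q_poch_ratio_bounded[of a] unfolding c_def by blast
  have summ: "summable (\<lambda>n. c n * y ^ n)" if "norm y < 1" for y
    by (rule summable_comparison_test'[OF summable_mult[OF summable_geometric[of "norm y"], of C]])
       (use that C in \<open>auto simp: norm_mult norm_power intro!: mult_right_mono\<close>)
  have F_sums: "(\<lambda>n. c n * y ^ n) sums F y" if "norm y < 1" for y
    using summ[OF that] unfolding F_def by (rule summable_sums)
  have rec: "c (Suc n) * (1 - of_real q ^ Suc n) = c n * (1 - a * of_real q ^ n)" for n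
  proof -
    have "norm (complex_of_real q) < 1" using q by simp
    from one_minus_ne_0_of_norm_less_1[OF this, of n] show ?thesis
      by (simp add: c_def q_poch_Suc)
  qed
  have feq: "(1 - y) * F y = (1 - a * y) * F (y * of_real q)" if y: "norm y < 1" for y
  proof -
    note yq = norm_mult_q_power_less_1[OF y, of 1, simplified]
    have "(\<lambda>n. c n * y ^ n - c n * (y * of_real q) ^ n) sums (F y - F (y * of_real q))"
      by (intro sums_diff F_sums y yq)
    then have "(\<lambda>n. c (Suc n) * y ^ Suc n - c (Suc n) * (y * of_real q) ^ Suc n)
                 sums (F y - F (y * of_real q))"
      by (subst sums_Suc_iff) simp
    moreover have "c (Suc n) * y ^ Suc n - c (Suc n) * (y * of_real q) ^ Suc n
                 = y * (c n * y ^ n - a * (c n * (y * of_real q) ^ n))" for n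
    proof -
      have "c (Suc n) * y ^ Suc n - c (Suc n) * (y * of_real q) ^ Suc n
          = (c (Suc n) * (1 - of_real q ^ Suc n)) * y ^ Suc n"
        unfolding power_mult_distrib by (simp only: algebra_simps mult_1_left)
      also have "\<dots> = y * (c n * y ^ n - a * (c n * (y * of_real q) ^ n))"
        unfolding rec by (simp add: power_mult_distrib algebra_simps)
      finally show ?thesis .
    qed
    moreover have "(\<lambda>n. y * (c n * y ^ n - a * (c n * (y * of_real q) ^ n)))
                     sums (y * (F y - a * F (y * of_real q)))"
      by (intro sums_mult sums_diff F_sums y yq)
    ultimately have "F y - F (y * of_real q) = y * (F y - a * F (y * of_real q))"
      by (simp add: sums_iff)
    then show ?thesis by (simp add: algebra_simps)
  qed
  have iter: "q_poch q z n * F z = q_poch q (a * z) n * F (z * of_real q ^ n)" for n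
  proof (induction n)
    case 0
    then show ?case by (simp add: q_poch_def)
  next
    case (Suc n)
    have "q_poch q z (Suc n) * F z = (1 - z * of_real q ^ n) * (q_poch q z n * F z)"
      by (simp add: q_poch_Suc)
    also have "\<dots> = q_poch q (a * z) n * ((1 - z * of_real q ^ n) * F (z * of_real q ^ n))"
      unfolding Suc by (simp add: mult_ac)
    also have "\<dots> = q_poch q (a * z) (Suc n) * F (z * of_real q ^ Suc n)"
      unfolding feq[OF norm_mult_q_power_less_1[OF z]] by (simp add: q_poch_Suc mult_ac)
    finally show ?case .
  qed
  \<comment> \<open>Any point strictly between \<open>0\<close> and the circle of convergence would serve as \<open>1/2\<close>.\<close>
  have "isCont F 0"
    unfolding F_def
    by (rule isCont_powser[where K = "1/2"]) (use summ[of "1/2"] in auto)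
  moreover have "(\<lambda>n. z * complex_of_real q ^ n) \<longlonglongrightarrow> z * 0"
    using q by (intro tendsto_intros LIMSEQ_power_zero) auto
  ultimately have "(\<lambda>n. F (z * of_real q ^ n)) \<longlonglongrightarrow> F 0"
    by (auto intro: isCont_tendsto_compose)
  moreover have "F 0 = 1"
    using powser_zero[of c] by (simp add: F_def c_def q_poch_def)
  ultimately have "(\<lambda>n. q_poch q (a * z) n * F (z * of_real q ^ n)) \<longlonglongrightarrow> q_poch_inf q (a * z)"
    using tendsto_mult[OF q_poch_LIMSEQ] by fastforce
  then have "(\<lambda>n. q_poch q z n * F z) \<longlonglongrightarrow> q_poch_inf q (a * z)"
    unfolding iter .
  moreover have "(\<lambda>n. q_poch q z n * F z) \<longlonglongrightarrow> q_poch_inf q z * F z"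
    by (intro tendsto_intros q_poch_LIMSEQ)
  ultimately have "q_poch_inf q z * F z = q_poch_inf q (a * z)"
    by (rule LIMSEQ_unique[symmetric])
  then have "F z = q_poch_inf q (a * z) / q_poch_inf q z"
    using q_poch_inf_nonzero[OF z] by (simp add: field_simps)
  then show ?thesis
    using F_sums[OF z] by (simp add: c_def)
qed

section \<open>The \<open>q\<close>-integral of the \<open>q\<close>-beta kernel\<close>

lemma norm_q_powr: "norm (complex_of_real q powr z) = q powr Re z"
  using q by (simp add: norm_powr_real_powr)

lemma norm_q_powr_less_1: "Re z > 0 \<Longrightarrow> norm (complex_of_real q powr z) < 1"
  using q powr_less_mono2[of "Re z" q 1] by (simp add: norm_q_powr)

lemma q_powr_add_nat:
  "complex_of_real q powr (z + of_nat m) = complex_of_real q powr z * of_real q ^ m"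
  using q by (simp add: powr_add powr_nat')

text \<open>
  Numerator and denominator on the left are tails of the infinite products \<open>(q;q)\<^sub>\<infinity>\<close> and
  \<open>(q powr y;q)\<^sub>\<infinity>\<close>; each is the full product divided by its first \<open>k\<close> factors.
\<close>

lemma jackson_kernel_eq:
  assumes "Re y > 0"
  shows "q_poch_inf q (of_real (q ^ k * q)) / q_poch_inf q (of_real (q ^ k) * of_real q powr y)
       = q_poch_inf q (of_real q) / q_poch_inf q (of_real q powr y)
         * (q_poch q (of_real q powr y) k / q_poch q (of_real q) k)"
proof -
  have n: "norm (complex_of_real q) < 1" "norm (complex_of_real q powr y) < 1"
    using q norm_q_powr_less_1[OF assms] by auto
  show ?thesis
    using q_poch_nonzero[OF n(1), of k] q_poch_nonzero[OF n(2), of k]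
    unfolding q_poch_inf_split[of "of_real q" k] q_poch_inf_split[of "of_real q powr y" k]
    by (simp add: mult_ac)
qed

lemma q_Beta_eq:
  assumes "Re x > 0" "Re y > 0"
  shows "q_Beta q x y = (1 - q) * (q_poch_inf q (of_real q) / q_poch_inf q (of_real q powr y)
           * (q_poch_inf q (of_real q powr (x + y)) / q_poch_inf q (of_real q powr x)))"
proof -
  have "q_poch_inf q (of_real q) \<noteq> 0"
    using q by (intro q_poch_inf_nonzero) auto
  moreover have "complex_of_real (1 - q) powr (1 - x) * of_real (1 - q) powr (1 - y)
                   = of_real (1 - q) * of_real (1 - q) powr (1 - (x + y))"
    using q by (simp add: powr_diff powr_add)
  moreover have "complex_of_real (1 - q) powr (1 - (x + y)) \<noteq> 0"
    using q by (simp del: of_real_diff)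
  ultimately show ?thesis
    unfolding q_Beta_def q_Gamma_def by (simp add: divide_simps)
qed

text \<open>
  This is the \<open>q\<close>-analogue of Euler's beta integral, written as the series over the nodes \<open>q ^ k\<close>.
  By the form of the kernel it is the \<open>q\<close>-binomial series with parameter \<open>q powr y\<close> at the point
  \<open>q powr x\<close>.
\<close>

lemma q_beta_sums:
  assumes x: "Re x > 0" and y: "Re y > 0"
  shows "(\<lambda>k. (of_real q powr x) ^ k *
            (q_poch_inf q (of_real (q ^ k * q)) / q_poch_inf q (of_real (q ^ k) * of_real q powr y)))
         sums (q_Beta q x y / of_real (1 - q))"
proof -
  let ?K = "q_poch_inf q (of_real q) / q_poch_inf q (of_real q powr y)"
  have "(\<lambda>k. ?K * (q_poch q (of_real q powr y) k / q_poch q (of_real q) k * (of_real q powr x) ^ k))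
     sums (?K * (q_poch_inf q (of_real q powr y * of_real q powr x) / q_poch_inf q (of_real q powr x)))"
    by (intro sums_mult q_binomial norm_q_powr_less_1 x)
  also have "?K * (q_poch_inf q (of_real q powr y * of_real q powr x) / q_poch_inf q (of_real q powr x))
      = q_Beta q x y / of_real (1 - q)"
    using q by (simp add: q_Beta_eq[OF x y] powr_add mult_ac)
  finally show ?thesis
    unfolding jackson_kernel_eq[OF y] by (simp add: mult_ac)
qed

section \<open>Convergence of the \<open>q\<close>-Mittag-Leffler series\<close>

text \<open>
  On the right half-plane \<open>(q powr z;q)\<^sub>\<infinity>\<close> is bounded, so only the power of \<open>1 - q\<close> matters.
\<close>

lemma norm_inverse_q_Gamma_le:
  obtains C where "C > 0"
    "\<And>z. Re z > 0 \<Longrightarrow> norm (1 / q_Gamma q z) \<le> C * (1 - q) powr Re z"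
proof
  let ?Q = "norm (q_poch_inf q (of_real q))"
  have Q: "?Q > 0"
    using q by (simp add: q_poch_inf_nonzero)
  then show "exp (1 / (1 - q)) / (?Q * (1 - q)) > 0"
    using q by simp
  fix z :: complex assume z: "Re z > 0"
  have "norm (1 / q_Gamma q z)
      = norm (q_poch_inf q (of_real q powr z)) / (?Q * (1 - q) powr (1 - Re z))"
    using q by (simp add: q_Gamma_def norm_mult norm_divide norm_powr_real_powr del: of_real_diff)
  also have "\<dots> \<le> exp (1 / (1 - q)) / (?Q * (1 - q) powr (1 - Re z))"
  proof (rule divide_right_mono)
    have "norm (q_poch_inf q (of_real q powr z)) \<le> exp (norm (complex_of_real q powr z) / (1 - q))"
      by (rule norm_q_poch_inf_le)
    also have "\<dots> \<le> exp (1 / (1 - q))"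
      using norm_q_powr_less_1[OF z] q by (simp add: divide_right_mono)
    finally show "norm (q_poch_inf q (of_real q powr z)) \<le> exp (1 / (1 - q))" .
  qed auto
  also have "\<dots> = exp (1 / (1 - q)) / (?Q * (1 - q)) * (1 - q) powr Re z"
    using q Q by (simp add: powr_diff field_simps)
  finally show "norm (1 / q_Gamma q z) \<le> exp (1 / (1 - q)) / (?Q * (1 - q)) * (1 - q) powr Re z" .
qed

lemma summable_q_ML:
  assumes \<eta>: "Re \<eta> > 0" and \<kappa>: "Re \<kappa> > 0" and u: "norm u < (1 - q) powr (- Re \<eta>)"
  shows "summable (\<lambda>m. norm (q_poch q l m / q_poch q (of_real q) m
                          * (u ^ m / q_Gamma q (\<eta> * of_nat m + \<kappa>))))"
proof -
  obtain C where C: "C > 0" "\<And>n. norm (q_poch q l n / q_poch q (of_real q) n) \<le> C"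
    using q_poch_ratio_bounded[of l] by blast
  obtain D where D: "D > 0" "\<And>z. Re z > 0 \<Longrightarrow> norm (1 / q_Gamma q z) \<le> D * (1 - q) powr Re z"
    using norm_inverse_q_Gamma_le by blast
  define r where "r = (1 - q) powr Re \<eta> * norm u"
  have "r < (1 - q) powr Re \<eta> * (1 - q) powr (- Re \<eta>)"
    unfolding r_def using q u by (intro mult_strict_left_mono) auto
  then have r: "0 \<le> r" "r < 1"
    using q by (auto simp: r_def powr_minus)
  show ?thesis
  proof (rule summable_comparison_test')
    show "summable (\<lambda>m. C * D * (1 - q) powr Re \<kappa> * r ^ m)"
      using r by (intro summable_mult summable_geometric) auto
    fix m :: nat
    have "Re (\<eta> * of_nat m + \<kappa>) > 0"
      using \<eta> \<kappa> by (simp add: add_nonneg_pos)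
    from D(2)[OF this]
    have G: "norm (1 / q_Gamma q (\<eta> * of_nat m + \<kappa>)) \<le> D * (((1 - q) powr Re \<eta>) ^ m * (1 - q) powr Re \<kappa>)"
      using q by (simp add: powr_add powr_powr[symmetric] powr_realpow)
    have "norm (q_poch q l m / q_poch q (of_real q) m * (u ^ m / q_Gamma q (\<eta> * of_nat m + \<kappa>)))
        = norm (q_poch q l m / q_poch q (of_real q) m)
          * (norm u ^ m * norm (1 / q_Gamma q (\<eta> * of_nat m + \<kappa>)))"
      by (simp add: norm_mult norm_divide norm_power)
    also have "\<dots> \<le> C * (norm u ^ m * (D * (((1 - q) powr Re \<eta>) ^ m * (1 - q) powr Re \<kappa>)))"
      using C G by (intro mult_mono mult_nonneg_nonneg) auto
    also have "\<dots> = C * D * (1 - q) powr Re \<kappa> * r ^ m"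
      by (simp add: r_def power_mult_distrib)
    finally show "norm (norm (q_poch q l m / q_poch q (of_real q) m
        * (u ^ m / q_Gamma q (\<eta> * of_nat m + \<kappa>)))) \<le> C * D * (1 - q) powr Re \<kappa> * r ^ m"
      by simp
  qed
qed

section \<open>The \<open>q\<close>-integral representation\<close>

text \<open>
  This is the mechanism of the main result, for an arbitrary power series: the \<open>q\<close>-integral against
  the \<open>q\<close>-beta kernel multiplies the \<open>m\<close>-th term by \<open>q_Beta q (x + m) y\<close>.  In the double series \<open>f\<close>
  below, summing a row over the nodes \<open>q ^ k\<close> gives the \<open>q\<close>-beta value, and summing a column over
  the exponents \<open>m\<close> gives the integrand at the node \<open>q ^ k\<close>, weighted by \<open>q ^ k\<close>.  Since
  \<open>q ^ m \<le> 1\<close>, the bound \<open>norm X ^ k\<close> on the geometric factor is uniform in \<open>m\<close>.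
\<close>

lemma q_beta_transform_sums:
  fixes a :: "nat \<Rightarrow> complex"
  assumes x: "Re x > 0" and y: "Re y > 0" and a: "summable (\<lambda>m. norm (a m * u ^ m))"
  shows "(\<lambda>m. q_Beta q (x + of_nat m) y * (a m * u ^ m)) sums
    q_integral q 1 (\<lambda>t. of_real t powr (x - 1)
      * (q_poch_inf q (of_real (t * q)) / q_poch_inf q (of_real t * of_real q powr y))
      * (\<Sum>m. a m * (of_real t * u) ^ m))"
proof -
  define w where "w k = q_poch_inf q (of_real (q ^ k * q))
                        / q_poch_inf q (of_real (q ^ k) * of_real q powr y)" for k
  define X where "X = complex_of_real q powr x"
  define f where "f m k = a m * u ^ m * (X * of_real q ^ m) ^ k * w k" for m k
  obtain C where C: "C > 0"
    "\<And>n. norm (q_poch q (of_real q powr y) n / q_poch q (of_real q) n) \<le> C"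
    using q_poch_ratio_bounded[of "of_real q powr y"] by blast
  define W where "W = norm (q_poch_inf q (of_real q) / q_poch_inf q (of_real q powr y)) * C"
  have W: "norm (w k) \<le> W" for k
    unfolding w_def jackson_kernel_eq[OF y] W_def norm_mult[of "_ / _"]
    by (intro mult_left_mono C) auto
  have X: "norm X < 1"
    unfolding X_def by (rule norm_q_powr_less_1[OF x])
  have W0: "0 \<le> W"
    using W[of 0] norm_ge_zero[of "w 0"] by linarith
  have swap: "(\<lambda>m. \<Sum>k. f m k) sums (\<Sum>k. \<Sum>m. f m k)"
  proof (rule suminf_swap_dominated)
    show "norm (f m k) \<le> norm (a m * u ^ m) * (norm X ^ k * W)" for m k
    proof -
      have "norm (X * of_real q ^ m) \<le> norm X * 1"
        unfolding norm_mult using q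
        by (intro mult_left_mono) (auto simp: norm_power power_le_one)
      then have "norm (X * of_real q ^ m) ^ k * norm (w k) \<le> norm X ^ k * W"
        using W[of k] by (intro mult_mono power_mono) auto
      then have "norm (a m * u ^ m) * (norm (X * of_real q ^ m) ^ k * norm (w k))
                   \<le> norm (a m * u ^ m) * (norm X ^ k * W)"
        by (rule mult_left_mono) auto
      then show ?thesis
        unfolding f_def by (simp add: norm_mult norm_power mult_ac)
    qed
    show "summable (\<lambda>k. norm X ^ k * W)"
      using X by (intro summable_mult2 summable_geometric) auto
  qed (use a W0 in auto)
  have row: "(\<Sum>k. f m k) = q_Beta q (x + of_nat m) y * (a m * u ^ m) / of_real (1 - q)" for m
  proof -
    have "(\<lambda>k. a m * u ^ m * ((of_real q powr (x + of_nat m)) ^ k * w k))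
            sums (a m * u ^ m * (q_Beta q (x + of_nat m) y / of_real (1 - q)))"
      unfolding w_def using x y by (intro sums_mult q_beta_sums) auto
    from sums_unique[OF this] show ?thesis
      unfolding f_def X_def q_powr_add_nat by (simp add: mult_ac)
  qed
  have column: "(\<Sum>m. f m k) = of_real (q ^ k) * (of_real (q ^ k) powr (x - 1) * w k
                   * (\<Sum>m. a m * (of_real (q ^ k) * u) ^ m))" for k
  proof -
    have "summable (\<lambda>m. a m * (of_real (q ^ k) * u) ^ m)"
    proof (rule summable_comparison_test'[OF a])
      fix m :: nat
      have "norm (a m * (of_real (q ^ k) * u) ^ m) = (q ^ k) ^ m * norm (a m * u ^ m)"
        using q by (simp add: norm_mult norm_power power_mult_distrib)
      also have "\<dots> \<le> 1 * norm (a m * u ^ m)"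
        using q by (intro mult_right_mono power_le_one) auto
      finally show "norm (a m * (of_real (q ^ k) * u) ^ m) \<le> norm (a m * u ^ m)" by simp
    qed
    from suminf_mult[OF this, of "X ^ k * w k"]
    have "(\<Sum>m. f m k) = X ^ k * w k * (\<Sum>m. a m * (of_real (q ^ k) * u) ^ m)"
      by (simp add: f_def power_mult_distrib power_mult[symmetric] mult_ac)
    moreover have "X ^ k = of_real (q ^ k) * of_real (q ^ k) powr (x - 1)"
    proof -
      have "complex_of_real (q ^ k) powr x = X ^ k"
        using q unfolding X_def
        by (simp add: powr_def Ln_of_real ln_realpow exp_of_nat_mult[symmetric] mult_ac
                 flip: of_real_power)
      then show ?thesis using q by (simp add: powr_diff)
    qed
    ultimately show ?thesis by simp
  qed
  have "(\<lambda>m. of_real (1 - q) * (\<Sum>k. f m k)) sums (of_real (1 - q) * (\<Sum>k. \<Sum>m. f m k))"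
    by (rule sums_mult[OF swap])
  then show ?thesis
    using q unfolding row column q_integral_def w_def by simp
qed

end

theorem theorem6p1:
  fixes q :: real and \<eta> \<kappa> \<sigma> c u :: complex
  assumes "0 < q" and "q < 1"
    and "Re \<eta> > 0" and "Re \<kappa> > 0"
    and "Re c > Re \<sigma>" and "Re \<sigma> > 0"
    and "norm u < (1 - q) powr (- Re \<eta>)"
  shows "q_ML_ext q \<eta> \<kappa> \<sigma> c u =
    1 / q_Beta q \<sigma> (c - \<sigma>) *
    q_integral q 1 (\<lambda>t. of_real t powr (\<sigma> - 1)
      * (q_poch_inf q (of_real (t * q)) / q_poch_inf q (of_real t * of_real q powr (c - \<sigma>)))
      * q_ML q \<eta> \<kappa> c (of_real t * u))"
proof -
  define a where "a m = q_poch q (of_real q powr c) m / q_poch q (of_real q) m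
                        / q_Gamma q (\<eta> * of_nat m + \<kappa>)" for m
  have q_ML_eq: "q_ML q \<eta> \<kappa> c v = (\<Sum>m. a m * v ^ m)" for v
    unfolding q_ML_def a_def by (simp add: mult_ac)
  have "summable (\<lambda>m. norm (a m * u ^ m))"
    using summable_q_ML[OF assms(1-4,7), of "of_real q powr c"] unfolding a_def
    by (simp add: mult_ac)
  then have "(\<lambda>m. q_Beta q (\<sigma> + of_nat m) (c - \<sigma>) * (a m * u ^ m)) sums
    q_integral q 1 (\<lambda>t. of_real t powr (\<sigma> - 1)
      * (q_poch_inf q (of_real (t * q)) / q_poch_inf q (of_real t * of_real q powr (c - \<sigma>)))
      * q_ML q \<eta> \<kappa> c (of_real t * u))"
    unfolding q_ML_eq using assms by (intro q_beta_transform_sums) auto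
  from sums_unique[OF sums_mult[OF this, of "1 / q_Beta q \<sigma> (c - \<sigma>)"]] show ?thesis
    unfolding q_ML_ext_def a_def by (simp add: mult_ac)
qed

end
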